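(* For any positive integer $n$, there is a simplicial complex $\mathrm{T}^{(n)}$ and a subcomplex $\Upsilon$ of $\mathrm{T}^{(n)}$ such that: (1) $\mathrm{T}^{(n)}$ is a shellable and contractible $2$-dimensional complex, having exactly $n$ free edges and no other free faces. Denote by $\mathcal{F}$ the set of free edges. (2) $\Upsilon\cup\langle\mathcal{F}\rangle$ is a shellable and contractible $1$-dimensional complex (that is, a tree), having exactly $n$ leaves; and so that for each leaf vertex, the unique edge containing it is in $\mathcal{F}$. (3) For any proper subset $\mathcal{E}\subsetneq\mathcal{F}$ of free edges, the relative complex $(\mathrm{T}^{(n)},\Upsilon\cup\langle\mathcal{E}\rangle)$ is shellable.
   Context: A simplicial complex is a (finite) family of finite sets, called faces, closed under taking subsets; facets are inclusion-maximal faces; a face with $k$ elements has dimension $k-1$, and an edge is a $1$-dimensional face. For a family of sets $\mathcal{E}$, $\langle\mathcal{E}\rangle$ is the simplicial complex consisting of all subsets of members of $\mathcal{E}$. A free face of $\Delta$ is a face $\tau\neq\emptyset$ which is properly contained in exactly one facet of $\Delta$; a free edge is a free face that is an edge. Contractibility refers to the geometric realization. A leaf of a tree is a vertex contained in exactly one edge. A simplicial complex $\Delta$ is shellable if there is an ordering $\sigma_1,\dots,\sigma_m$ of its facets such that each $\sigma_j$ with $j>1$ intersects the complex generated by $\sigma_1,\dots,\sigma_{j-1}$ in a pure $((\dim\sigma_j)-1)$-dimensional complex. A relative simplicial complex is a pair $(\Delta,\Gamma)$ where $\Gamma$ is a subcomplex of $\Delta$; its faces are the faces of $\Delta$ that are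 not faces of $\Gamma$, and its facets are its inclusion-maximal faces. It is shellable if there is an ordering $\sigma_1,\dots,\sigma_m$ of its facets such that for each $j$, the set of subsets of $\sigma_j$ that are neither contained in some $\sigma_i$ with $i<j$ nor in $\Gamma$ has a unique minimal element under inclusion.
   Formalization: The claim that the tree has exactly n leaves is asserted only for n ≥ 2, since for n = 1 it is false: a finite tree with at least one edge has at least two leaves. All other claims are asserted for every n ≥ 1. *)

theory Defs
  imports "HOL-Analysis.Analysis"
begin

text \<open>
  Finite abstract simplicial complexes, given by their sets of faces. The empty face is a face of
  every complex except the void complex \<open>{}\<close>, which is allowed.
\<close>

definition abstract_complex :: "'a set set \<Rightarrow> bool" where
  "abstract_complex \<Delta> \<longleftrightarrow>
     finite \<Delta> \<and> (\<forall>\<sigma>\<in>\<Delta>. finite \<sigma>) \<and> (\<forall>\<sigma>\<in>\<Delta>. \<forall>\<tau>. \<tau> \<subseteq> \<sigma> \<longrightarrow> \<tau> \<in> \<Delta>)"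

definition subcomplex :: "'a set set \<Rightarrow> 'a set set \<Rightarrow> bool" where
  "subcomplex \<Gamma> \<Delta> \<longleftrightarrow> abstract_complex \<Gamma> \<and> \<Gamma> \<subseteq> \<Delta>"

definition generated :: "'a set set \<Rightarrow> 'a set set" where
  "generated E = {\<tau>. \<exists>\<sigma>\<in>E. \<tau> \<subseteq> \<sigma>}"

text \<open>An integer, so that the empty face has dimension \<open>-1\<close>.\<close>

definition face_dim :: "'a set \<Rightarrow> int" where
  "face_dim \<sigma> = int (card \<sigma>) - 1"

definition has_dim :: "'a set set \<Rightarrow> int \<Rightarrow> bool" where
  "has_dim \<Delta> d \<longleftrightarrow> (\<exists>\<sigma>\<in>\<Delta>. face_dim \<sigma> = d) \<and> (\<forall>\<sigma>\<in>\<Delta>. face_dim \<sigma> \<le> d)"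

text \<open>
  Defined for an arbitrary family of sets, so that it also applies to the faces of a relative
  complex.
\<close>

definition facets :: "'a set set \<Rightarrow> 'a set set" where
  "facets \<Delta> = {\<sigma> \<in> \<Delta>. \<forall>\<tau>\<in>\<Delta>. \<sigma> \<subseteq> \<tau> \<longrightarrow> \<tau> = \<sigma>}"

definition pure_of_dim :: "'a set set \<Rightarrow> int \<Rightarrow> bool" where
  "pure_of_dim \<Delta> d \<longleftrightarrow> has_dim \<Delta> d \<and> (\<forall>\<sigma>\<in>facets \<Delta>. face_dim \<sigma> = d)"

definition edges :: "'a set set \<Rightarrow> 'a set set" where
  "edges \<Delta> = {\<sigma> \<in> \<Delta>. face_dim \<sigma> = 1}"

definition free_faces :: "'a set set \<Rightarrow> 'a set set" where
  "free_faces \<Delta> = {\<tau> \<in> \<Delta>. \<tau> \<noteq> {} \<and> (\<exists>!\<sigma>. \<sigma> \<in> facets \<Delta> \<and> \<tau> \<subset> \<sigma>)}"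

definition free_edges :: "'a set set \<Rightarrow> 'a set set" where
  "free_edges \<Delta> = free_faces \<Delta> \<inter> edges \<Delta>"

text \<open>
  A finite tree with an edge has at least two leaves, so a count of exactly one leaf cannot occur.
\<close>

definition leaves :: "'a set set \<Rightarrow> 'a set" where
  "leaves \<Delta> = {v \<in> \<Union>\<Delta>. \<exists>!e. e \<in> edges \<Delta> \<and> v \<in> e}"

text \<open>
  Points are given by barycentric coordinates. As the complexes are finite, the topology induced
  by the product topology on \<^typ>\<open>'a \<Rightarrow> real\<close> is the usual one.
\<close>

definition realization :: "'a set set \<Rightarrow> ('a \<Rightarrow> real) set" where
  "realization \<Delta> =
     {x. (\<forall>v. 0 \<le> x v) \<and> {v. x v \<noteq> 0} \<in> \<Delta> \<and> (\<Sum>v | x v \<noteq> 0. x v) = 1}"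

definition contractible_complex :: "'a set set \<Rightarrow> bool" where
  "contractible_complex \<Delta> \<longleftrightarrow> contractible (realization \<Delta>)"

text \<open>Shellability in the nonpure sense; the list is the ordering of the facets.\<close>

definition shelling :: "'a set set \<Rightarrow> 'a set list \<Rightarrow> bool" where
  "shelling \<Delta> \<sigma>s \<longleftrightarrow> distinct \<sigma>s \<and> set \<sigma>s = facets \<Delta> \<and>
     (\<forall>j. 0 < j \<and> j < length \<sigma>s \<longrightarrow>
        pure_of_dim (generated {\<sigma>s ! j} \<inter> generated (set (take j \<sigma>s))) (face_dim (\<sigma>s ! j) - 1))"

definition shellable :: "'a set set \<Rightarrow> bool" where
  "shellable \<Delta> \<longleftrightarrow> (\<exists>\<sigma>s. shelling \<Delta> \<sigma>s)"

text \<open>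
  The relative complex \<open>(\<Delta>, \<Gamma>)\<close> has face set \<open>\<Delta> - \<Gamma>\<close>, so its facets are \<open>facets (\<Delta> - \<Gamma>)\<close>.
\<close>

definition minimal_sets :: "'a set set \<Rightarrow> 'a set set" where
  "minimal_sets S = {\<tau> \<in> S. \<forall>\<rho>\<in>S. \<rho> \<subseteq> \<tau> \<longrightarrow> \<rho> = \<tau>}"

definition relative_shelling :: "'a set set \<Rightarrow> 'a set set \<Rightarrow> 'a set list \<Rightarrow> bool" where
  "relative_shelling \<Delta> \<Gamma> \<sigma>s \<longleftrightarrow> distinct \<sigma>s \<and> set \<sigma>s = facets (\<Delta> - \<Gamma>) \<and>
     (\<forall>j < length \<sigma>s.
        \<exists>!\<tau>. \<tau> \<in> minimal_sets {\<rho>. \<rho> \<subseteq> \<sigma>s ! j \<and> (\<forall>i < j. \<not> \<rho> \<subseteq> \<sigma>s ! i) \<and> \<rho> \<notin> \<Gamma>})"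

definition relative_shellable :: "'a set set \<Rightarrow> 'a set set \<Rightarrow> bool" where
  "relative_shellable \<Delta> \<Gamma> \<longleftrightarrow> subcomplex \<Gamma> \<Delta> \<and> (\<exists>\<sigma>s. relative_shelling \<Delta> \<Gamma> \<sigma>s)"

end

theory Submission
  imports Defs
begin

text \<open>
  The complex \<open>T\<close> is a union of \<open>n\<close> discs, the blades, arranged cyclically around a common vertex \<open>c\<close>, the
  hub. Blade \<open>j\<close> is a disc whose boundary is glued along the word
  \<open>f\<^sub>j e\<^sub>j e\<^sub>j\<^sub>+\<^sub>1\<^sup>-\<^sup>1 e\<^sub>j\<^sub>+\<^sub>1\<close>, where \<open>f\<^sub>j\<close> is an edge from \<open>c\<close> to
  the tip \<open>a\<^sub>j\<close> and \<open>e\<^sub>j\<close> is a path of two edges from \<open>a\<^sub>j\<close> back to \<open>c\<close>; for \<open>n = 1\<close> this is a dunce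
  hat with one free edge. The path \<open>e\<^sub>j\<close> is used once by blade \<open>j\<close> and twice by blade \<open>j - 1\<close>, so the
  tip edges \<open>f\<^sub>j\<close> are the only free faces.

  The point of the construction is that \<open>T\<close> can be collapsed starting from any single tip edge \<open>f\<^sub>i\<close>
  while all the others are kept. Once blade \<open>i\<close> is gone, the path \<open>e\<^sub>i\<^sub>+\<^sub>1\<close> is used only once, by
  blade \<open>i + 1\<close>, which can now be removed from there; this frees \<open>e\<^sub>i\<^sub>+\<^sub>2\<close>, and so on around the cycle.
  At the end only the other tip edges are left, the dangling path \<open>e\<^sub>i\<close> being removed with the last blade.
  Read backwards, this is a relative shelling that ends with \<open>f\<^sub>i\<close>. For a proper subset \<open>E\<close> of the tip
  edges, the missing edge \<open>f\<^sub>i\<close> is chosen such that \<open>f\<^sub>i\<^sub>-\<^sub>1 \<in> E\<close> (unless \<open>E\<close> is empty), because the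
  first triangle of the shelling needs an old edge to be glued to. This works relative to \<open>\<langle>E\<rangle>\<close>
  alone, so \<open>\<Upsilon>\<close> can be taken to be void, and \<open>\<Upsilon> \<union> \<langle>F\<rangle>\<close> is the star with center \<open>c\<close> and leaves
  \<open>a\<^sub>j\<close>.

  Every step after the first glues a triangle along one or two old edges in such a way that the new faces
  are those containing a restriction face \<open>R\<close> different from the triangle. The lemmas
  \<open>buildable_relative_shellable\<close>,
  \<open>buildable_shellable\<close> and \<open>buildable_contractible\<close> turn such a sequence of gluings into the required
  properties; \<open>buildable_turbine_relative\<close> provides the sequences, and
  \<open>free_faces_turbine\<close> counts the free faces.
\<close>

section \<open>Complexes built by gluing facets\<close>

text \<open>
  \<open>R\<close> is the restriction face of \<open>\<sigma>\<close>: for a complex \<open>\<Delta>\<close>, the condition says that the faces of \<open>\<sigma>\<close>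
  outside \<open>\<Delta>\<close> are exactly those between \<open>R\<close> and \<open>\<sigma>\<close>. Requiring \<open>R \<noteq> \<sigma>\<close> forbids gluing along the whole
  boundary of \<open>\<sigma>\<close>, which would create a sphere up to homotopy; gluing then preserves contractibility.
\<close>

definition glues_along :: "'a set set \<Rightarrow> 'a set \<Rightarrow> 'a set \<Rightarrow> bool" where
  "glues_along \<Delta> \<sigma> R \<longleftrightarrow> R \<subset> \<sigma> \<and> R \<notin> \<Delta> \<and> (\<forall>v\<in>R. \<sigma> - {v} \<in> \<Delta>)"

fun buildable :: "'a set set \<Rightarrow> 'a set list \<Rightarrow> bool" where
  "buildable \<Delta> [] \<longleftrightarrow> True"
| "buildable \<Delta> (\<sigma> # \<sigma>s) \<longleftrightarrow> (\<exists>R. glues_along \<Delta> \<sigma> R) \<and> buildable (\<Delta> \<union> Pow \<sigma>) \<sigma>s"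

lemma generated_empty [simp]: "generated {} = {}"
  by (auto simp: generated_def)

lemma generated_insert: "generated (insert \<sigma> S) = Pow \<sigma> \<union> generated S"
  by (auto simp: generated_def)

lemma mem_generatedI: "\<tau> \<subseteq> \<sigma> \<Longrightarrow> \<sigma> \<in> S \<Longrightarrow> \<tau> \<in> generated S"
  by (auto simp: generated_def)

lemma generated_mono: "S \<subseteq> S' \<Longrightarrow> generated S \<subseteq> generated S'"
  by (auto simp: generated_def)

lemma abstract_complex_subset: "abstract_complex \<Delta> \<Longrightarrow> \<sigma> \<in> \<Delta> \<Longrightarrow> \<tau> \<subseteq> \<sigma> \<Longrightarrow> \<tau> \<in> \<Delta>"
  by (auto simp: abstract_complex_def)

lemma generated_subset:
  assumes "abstract_complex \<Delta>" "E \<subseteq> \<Delta>"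
  shows "generated E \<subseteq> \<Delta>"
  using abstract_complex_subset[OF assms(1)] assms(2) unfolding generated_def by blast

lemma abstract_complex_Un:
  "abstract_complex \<Delta> \<Longrightarrow> abstract_complex \<Gamma> \<Longrightarrow> abstract_complex (\<Delta> \<union> \<Gamma>)"
  by (auto simp: abstract_complex_def)

lemma abstract_complex_Pow: "finite \<sigma> \<Longrightarrow> abstract_complex (Pow \<sigma>)"
  by (auto simp: abstract_complex_def intro: finite_subset)

lemma abstract_complex_generated:
  assumes "finite S" "\<And>\<sigma>. \<sigma> \<in> S \<Longrightarrow> finite \<sigma>"
  shows "abstract_complex (generated S)"
  using assms
  by (induction S rule: finite_induct)
     (auto simp: generated_insert abstract_complex_Un abstract_complex_Pow,
      simp add: abstract_complex_def)

lemma buildable_append: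
  "buildable \<Delta> (\<sigma>s @ \<tau>s) \<longleftrightarrow> buildable \<Delta> \<sigma>s \<and> buildable (\<Delta> \<union> generated (set \<sigma>s)) \<tau>s"
  by (induction \<sigma>s arbitrary: \<Delta>) (auto simp: generated_insert Un_assoc)

text \<open>
  A face of \<open>\<sigma>\<close> that misses some \<open>v \<in> R\<close> lies in \<open>\<sigma> - {v}\<close> and is therefore old; a face that contains
  \<open>R\<close> is new because \<open>R\<close> is.
\<close>

lemma glues_along_new_faces:
  assumes "abstract_complex \<Delta>" "glues_along \<Delta> \<sigma> R"
  shows "\<rho> \<subseteq> \<sigma> \<and> \<rho> \<notin> \<Delta> \<longleftrightarrow> R \<subseteq> \<rho> \<and> \<rho> \<subseteq> \<sigma>"
proof
  assume \<rho>: "\<rho> \<subseteq> \<sigma> \<and> \<rho> \<notin> \<Delta>"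
  have "v \<in> \<rho>" if "v \<in> R" for v
  proof (rule ccontr)
    assume "v \<notin> \<rho>"
    then have "\<rho> \<subseteq> \<sigma> - {v}" using \<rho> by auto
    then show False
      using abstract_complex_subset[OF assms(1)] assms(2) that \<rho> unfolding glues_along_def by blast
  qed
  then show "R \<subseteq> \<rho> \<and> \<rho> \<subseteq> \<sigma>" using \<rho> by auto
next
  assume "R \<subseteq> \<rho> \<and> \<rho> \<subseteq> \<sigma>"
  then show "\<rho> \<subseteq> \<sigma> \<and> \<rho> \<notin> \<Delta>"
    using abstract_complex_subset[OF assms(1)] assms(2) unfolding glues_along_def by blast
qed

lemma buildable_nth:
  assumes "buildable \<Delta> \<sigma>s" "j < length \<sigma>s"
  shows "\<exists>R. glues_along (\<Delta> \<union> generated (set (take j \<sigma>s))) (\<sigma>s ! j) R"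
proof -
  have "\<sigma>s = take j \<sigma>s @ \<sigma>s ! j # drop (Suc j) \<sigma>s"
    using assms(2) by (simp add: id_take_nth_drop)
  then have "buildable (\<Delta> \<union> generated (set (take j \<sigma>s))) (\<sigma>s ! j # drop (Suc j) \<sigma>s)"
    using assms(1) buildable_append by metis
  then show ?thesis by simp
qed

lemma buildable_facet_is_new:
  assumes "abstract_complex \<Delta>" "\<And>\<sigma>. \<sigma> \<in> set \<sigma>s \<Longrightarrow> finite \<sigma>" "buildable \<Delta> \<sigma>s" "j < length \<sigma>s"
  shows "\<sigma>s ! j \<notin> \<Delta> \<union> generated (set (take j \<sigma>s))"
proof -
  have "abstract_complex (\<Delta> \<union> generated (set (take j \<sigma>s)))"
    using assms(1,2) by (intro abstract_complex_Un abstract_complex_generated)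
      (auto dest: in_set_takeD)
  from abstract_complex_subset[OF this] show ?thesis
    using buildable_nth[OF assms(3,4)] unfolding glues_along_def by blast
qed

lemma buildable_distinct:
  assumes "abstract_complex \<Delta>" "\<And>\<sigma>. \<sigma> \<in> set \<sigma>s \<Longrightarrow> finite \<sigma>" "buildable \<Delta> \<sigma>s"
  shows "distinct \<sigma>s" "set \<sigma>s \<inter> \<Delta> = {}"
proof -
  have new: "\<sigma>s ! j \<notin> \<Delta>" "\<sigma>s ! j \<notin> set (take j \<sigma>s)" if "j < length \<sigma>s" for j
    using buildable_facet_is_new[OF assms that] by (auto simp: generated_def)
  show "set \<sigma>s \<inter> \<Delta> = {}"
    using new(1) by (auto simp: in_set_conv_nth)
  have "\<sigma>s ! i \<noteq> \<sigma>s ! j" if "i < j" "j < length \<sigma>s" for i j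
    using new(2)[OF that(2)] that by (auto simp: in_set_conv_nth)
  then show "distinct \<sigma>s"
    unfolding distinct_conv_nth by (metis linorder_neqE_nat)
qed

text \<open>
  Equality of the cardinalities makes \<open>S\<close> an antichain, so that no member of \<open>S\<close> is absorbed by another.
\<close>

lemma facets_generated_minus:
  assumes "\<And>\<sigma>. \<sigma> \<in> S \<Longrightarrow> finite \<sigma> \<and> card \<sigma> = d" "S \<inter> \<Gamma> = {}"
  shows "facets (generated S - \<Gamma>) = S"
proof
  show "facets (generated S - \<Gamma>) \<subseteq> S"
  proof
    fix \<tau> assume \<tau>: "\<tau> \<in> facets (generated S - \<Gamma>)"
    then obtain \<sigma> where "\<sigma> \<in> S" "\<tau> \<subseteq> \<sigma>" unfolding facets_def generated_def by blast
    moreover from this have "\<sigma> \<in> generated S - \<Gamma>"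
      using assms(2) by (auto simp: generated_def)
    ultimately show "\<tau> \<in> S" using \<tau> by (auto simp: facets_def)
  qed
  show "S \<subseteq> facets (generated S - \<Gamma>)"
  proof
    fix \<sigma> assume \<sigma>: "\<sigma> \<in> S"
    have "\<tau> = \<sigma>" if \<tau>: "\<tau> \<in> generated S" "\<sigma> \<subseteq> \<tau>" for \<tau>
    proof -
      obtain \<sigma>' where "\<sigma>' \<in> S" "\<tau> \<subseteq> \<sigma>'" using \<tau>(1) unfolding generated_def by blast
      moreover from this have "\<sigma> = \<sigma>'"
        using assms(1) \<sigma> \<tau>(2) by (metis card_subset_eq order_trans)
      ultimately show ?thesis using \<tau>(2) by auto
    qed
    then show "\<sigma> \<in> facets (generated S - \<Gamma>)"
      using \<sigma> assms(2) by (auto simp: facets_def generated_def)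
  qed
qed

lemma facets_generated:
  assumes "\<And>\<sigma>. \<sigma> \<in> S \<Longrightarrow> finite \<sigma> \<and> card \<sigma> = d"
  shows "facets (generated S) = S"
  using facets_generated_minus[OF assms, where \<Gamma> = "{}"] by simp

lemma pure_of_dim_generated:
  assumes "\<And>\<sigma>. \<sigma> \<in> S \<Longrightarrow> finite \<sigma> \<and> card \<sigma> = d" "S \<noteq> {}"
  shows "pure_of_dim (generated S) (int d - 1)"
proof -
  have le: "face_dim \<tau> \<le> int d - 1" if "\<tau> \<in> generated S" for \<tau>
  proof -
    obtain \<sigma> where "\<sigma> \<in> S" "\<tau> \<subseteq> \<sigma>" using \<open>\<tau> \<in> generated S\<close> unfolding generated_def by blast
    then have "card \<tau> \<le> d" using assms(1) card_mono by metis
    then show ?thesis by (simp add: face_dim_def)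
  qed
  have eq: "face_dim \<sigma> = int d - 1" if "\<sigma> \<in> S" for \<sigma>
    using assms(1)[OF that] by (simp add: face_dim_def)
  have facets: "facets (generated S) = S"
    by (rule facets_generated[OF assms(1)])
  obtain \<sigma> where "\<sigma> \<in> S" using assms(2) by blast
  then have "\<exists>\<sigma>\<in>generated S. face_dim \<sigma> = int d - 1"
    using eq mem_generatedI by blast
  then show ?thesis
    using le eq by (simp add: pure_of_dim_def has_dim_def facets)
qed

text \<open>
  The restriction face of each gluing step is the unique minimal new face that a relative shelling asks for.
\<close>

lemma buildable_relative_shellable:
  assumes "\<And>\<sigma>. \<sigma> \<in> set \<sigma>s \<Longrightarrow> finite \<sigma> \<and> card \<sigma> = d"
    and "subcomplex \<Gamma> (generated (set \<sigma>s))" "buildable \<Gamma> \<sigma>s"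
  shows "relative_shellable (generated (set \<sigma>s)) \<Gamma>"
proof -
  have \<Gamma>: "abstract_complex \<Gamma>" using assms(2) by (simp add: subcomplex_def)
  have dist: "distinct \<sigma>s" "set \<sigma>s \<inter> \<Gamma> = {}"
    using buildable_distinct[OF \<Gamma> _ assms(3)] assms(1) by auto
  have "\<exists>!\<tau>. \<tau> \<in> minimal_sets {\<rho>. \<rho> \<subseteq> \<sigma>s ! j \<and> (\<forall>i < j. \<not> \<rho> \<subseteq> \<sigma>s ! i) \<and> \<rho> \<notin> \<Gamma>}"
    if j: "j < length \<sigma>s" for j
  proof -
    let ?\<Delta> = "\<Gamma> \<union> generated (set (take j \<sigma>s))"
    obtain R where R: "glues_along ?\<Delta> (\<sigma>s ! j) R"
      using buildable_nth[OF assms(3) j] by blast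
    have "abstract_complex ?\<Delta>"
      using \<Gamma> assms(1) by (intro abstract_complex_Un abstract_complex_generated)
        (auto dest: in_set_takeD)
    note new = glues_along_new_faces[OF this R]
    have "\<rho> \<in> generated (set (take j \<sigma>s)) \<longleftrightarrow> (\<exists>i<j. \<rho> \<subseteq> \<sigma>s ! i)" for \<rho>
    proof -
      have "set (take j \<sigma>s) = (!) \<sigma>s ` {..<j}"
        using nth_image[of j \<sigma>s] j by (simp add: lessThan_atLeast0)
      then show ?thesis by (auto simp: generated_def)
    qed
    then have "{\<rho>. \<rho> \<subseteq> \<sigma>s ! j \<and> (\<forall>i < j. \<not> \<rho> \<subseteq> \<sigma>s ! i) \<and> \<rho> \<notin> \<Gamma>} = {\<rho>. R \<subseteq> \<rho> \<and> \<rho> \<subseteq> \<sigma>s ! j}"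
      using new by (intro Collect_cong) (metis UnE UnI1 UnI2)
    moreover have "\<tau> \<in> minimal_sets {\<rho>. R \<subseteq> \<rho> \<and> \<rho> \<subseteq> \<sigma>s ! j} \<longleftrightarrow> \<tau> = R" for \<tau>
      using R by (auto simp: minimal_sets_def glues_along_def)
    ultimately show ?thesis by simp
  qed
  then show ?thesis
    unfolding relative_shellable_def relative_shelling_def
    using dist assms(2) facets_generated_minus[OF assms(1) dist(2)] by auto
qed

text \<open>
  With restriction face \<open>R\<close>, the old part of a facet \<open>\<sigma>\<close> is generated by the ridges \<open>\<sigma> - {v}\<close> with
  \<open>v \<in> R\<close>, so it is pure of codimension one. There is at least one such ridge after the first step,
  because the empty face is old by then.
\<close>

lemma buildable_shellable:
  assumes "\<And>\<sigma>. \<sigma> \<in> set \<sigma>s \<Longrightarrow> finite \<sigma> \<and> card \<sigma> = Suc d" "buildable {} \<sigma>s"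
  shows "shellable (generated (set \<sigma>s))"
proof -
  have dist: "distinct \<sigma>s"
    using buildable_distinct[OF _ _ assms(2)] assms(1) by (auto simp: abstract_complex_def)
  have "pure_of_dim (generated {\<sigma>s ! j} \<inter> generated (set (take j \<sigma>s))) (face_dim (\<sigma>s ! j) - 1)"
    if j: "0 < j" "j < length \<sigma>s" for j
  proof -
    let ?\<sigma> = "\<sigma>s ! j" and ?\<Delta> = "generated (set (take j \<sigma>s))"
    obtain R where R: "glues_along ?\<Delta> ?\<sigma> R"
      using buildable_nth[OF assms(2) j(2)] by auto
    have \<sigma>: "finite ?\<sigma>" "card ?\<sigma> = Suc d" using assms(1) j by auto
    have "abstract_complex ?\<Delta>"
      using assms(1) by (intro abstract_complex_generated) (auto dest: in_set_takeD)
    note new = glues_along_new_faces[OF this R]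
    have "{} \<in> ?\<Delta>"
      using j mem_generatedI[of "{}" "\<sigma>s ! 0" "set (take j \<sigma>s)"]
      by (force simp: in_set_conv_nth)
    then have "R \<noteq> {}" using R by (auto simp: glues_along_def)
    have "generated {?\<sigma>} \<inter> ?\<Delta> = {\<rho>. \<rho> \<subseteq> ?\<sigma> \<and> \<not> R \<subseteq> \<rho>}"
      using new by (auto simp: generated_insert)
    also have "\<dots> = generated ((\<lambda>v. ?\<sigma> - {v}) ` R)"
      using R by (fastforce simp: generated_def glues_along_def)
    finally have eq: "generated {?\<sigma>} \<inter> ?\<Delta> = generated ((\<lambda>v. ?\<sigma> - {v}) ` R)" .
    have "pure_of_dim (generated ((\<lambda>v. ?\<sigma> - {v}) ` R)) (int d - 1)"
      using \<sigma> R \<open>R \<noteq> {}\<close> by (intro pure_of_dim_generated) (auto simp: glues_along_def)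
    then show ?thesis using \<sigma> by (simp add: eq face_dim_def)
  qed
  then show ?thesis
    unfolding shellable_def shelling_def
    using dist facets_generated[OF assms(1)] by auto
qed

section \<open>Contractibility of the realization\<close>

text \<open>
  Realizations live in a function space with the product topology, which is not normed; continuity of the
  homotopy is checked coordinate by coordinate.
\<close>

lemma homotopic_straight_line:
  fixes f g :: "'b::topological_space \<Rightarrow> 'a \<Rightarrow> real"
  assumes "continuous_on S f" "continuous_on S g"
    and "\<And>x t. x \<in> S \<Longrightarrow> 0 \<le> t \<Longrightarrow> t \<le> 1 \<Longrightarrow> (\<lambda>v. (1 - t) * f x v + t * g x v) \<in> T"
  shows "homotopic_with_canon (\<lambda>_. True) S T f g"
proof -
  let ?h = "\<lambda>y. \<lambda>v. (1 - fst y) * f (snd y) v + fst y * g (snd y) v"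
  have comp: "continuous_on ({0..1} \<times> S) (\<lambda>y. k (snd y) v)"
    if "continuous_on S k" for k :: "'b \<Rightarrow> 'a \<Rightarrow> real" and v
    by (rule continuous_on_compose2[OF continuous_on_product_then_coordinatewise[OF that]])
       (auto intro: continuous_on_snd continuous_on_id)
  have "continuous_on ({0..1::real} \<times> S) ?h"
    by (rule continuous_on_coordinatewise_then_product)
       (intro continuous_intros comp assms(1,2))
  moreover have "?h ` ({0..1} \<times> S) \<subseteq> T"
    using assms(3) by auto
  ultimately show ?thesis
    unfolding homotopic_with_def by (intro exI[of _ ?h]) auto
qed

lemma continuous_on_Min:
  fixes f :: "'i \<Rightarrow> 'b::topological_space \<Rightarrow> real"
  assumes "finite I" "I \<noteq> {}" "\<And>i. i \<in> I \<Longrightarrow> continuous_on S (f i)"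
  shows "continuous_on S (\<lambda>x. Min ((\<lambda>i. f i x) ` I))"
  using assms
proof (induction I rule: finite_ne_induct)
  case (insert i I)
  then show ?case by (simp add: continuous_on_min)
qed simp

lemma contractible_simplex:
  assumes "finite \<sigma>" "w \<in> \<sigma>"
  shows "contractible_complex (Pow \<sigma>)"
proof -
  let ?g = "\<lambda>x :: 'a \<Rightarrow> real. \<lambda>v. if v = w then 1 else (0::real)"
  have mem: "x \<in> realization (Pow \<sigma>) \<longleftrightarrow> (\<forall>v. 0 \<le> x v) \<and> (\<forall>v. v \<notin> \<sigma> \<longrightarrow> x v = 0) \<and> sum x \<sigma> = 1" for x
  proof -
    have "(\<Sum>v | x v \<noteq> 0. x v) = sum x \<sigma>" if "{v. x v \<noteq> 0} \<subseteq> \<sigma>"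
      using that assms(1) by (intro sum.mono_neutral_left) auto
    moreover have "{v. x v \<noteq> 0} \<subseteq> \<sigma> \<longleftrightarrow> (\<forall>v. v \<notin> \<sigma> \<longrightarrow> x v = 0)"
      by auto
    ultimately show ?thesis unfolding realization_def by auto
  qed
  have "homotopic_with_canon (\<lambda>_. True) (realization (Pow \<sigma>)) (realization (Pow \<sigma>)) id ?g"
  proof (rule homotopic_straight_line)
    fix x :: "'a \<Rightarrow> real" and t :: real
    assume "x \<in> realization (Pow \<sigma>)" and t: "0 \<le> t" "t \<le> 1"
    then show "(\<lambda>v. (1 - t) * id x v + t * ?g x v) \<in> realization (Pow \<sigma>)"
      using assms by (auto simp: mem sum.distrib sum_distrib_left[symmetric])
  qed (auto intro: continuous_on_id continuous_on_const)
  then show ?thesis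
    unfolding contractible_complex_def contractible_def by blast
qed

text \<open>
  Gluing a simplex along a proper nonempty face is an elementary expansion. Fix a vertex \<open>w\<close> of \<open>\<sigma>\<close>
  outside \<open>R\<close>. The retraction \<open>r\<close> onto the old complex lowers all coordinates in \<open>R\<close> by their minimum \<open>m\<close>
  and moves the freed weight to \<open>w\<close>. A coordinate in \<open>R\<close> becomes \<open>0\<close>, so the support of \<open>r x\<close> is an old
  face; and \<open>m > 0\<close> only if the support of \<open>x\<close> contains \<open>R\<close>, hence is new and lies in \<open>\<sigma>\<close>, so \<open>r\<close> fixes
  all old points and the segment from \<open>x\<close> to \<open>r x\<close> stays in the simplex. The formula for \<open>r\<close> is
  continuous on the whole space, which avoids any gluing of partial maps.
\<close>

lemma contractible_glue:
  assumes \<Delta>: "abstract_complex \<Delta>" and glue: "glues_along \<Delta> \<sigma> R"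
    and "finite \<sigma>" "R \<noteq> {}" and contr: "contractible_complex \<Delta>"
  shows "contractible_complex (\<Delta> \<union> Pow \<sigma>)"
proof -
  let ?X = "realization (\<Delta> \<union> Pow \<sigma>)" and ?Y = "realization \<Delta>"
  obtain w where w: "w \<in> \<sigma>" "w \<notin> R" using glue by (auto simp: glues_along_def)
  have R: "R \<subseteq> \<sigma>" "finite R" "R \<notin> \<Delta>"
    using glue \<open>finite \<sigma>\<close> by (auto simp: glues_along_def intro: finite_subset)
  define m :: "('a \<Rightarrow> real) \<Rightarrow> real" where "m x = Min (x ` R)" for x
  define r where "r x = (\<lambda>v. if v \<in> R then x v - m x else if v = w then x v + m x * card R else x v)"
    for x :: "'a \<Rightarrow> real"
  have m_le: "m x \<le> x v" if "v \<in> R" for x v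
    using that R(2) by (simp add: m_def)
  have m_nonneg: "0 \<le> m x" if "x \<in> ?X" for x
    using that R(2) \<open>R \<noteq> {}\<close> by (simp add: m_def realization_def)
  have m_attained: "\<exists>v\<in>R. x v = m x" for x
    using Min_in[of "x ` R"] R(2) \<open>R \<noteq> {}\<close> by (fastforce simp: m_def)
  have r_fix: "r x = x" if "m x = 0" for x
    using that by (auto simp: r_def)
  have supp: "{v. x v \<noteq> 0} \<subseteq> \<sigma>" if "x \<in> ?X" "m x \<noteq> 0" for x
  proof -
    have "R \<subseteq> {v. x v \<noteq> 0}"
      using m_le[of _ x] m_nonneg[OF that(1)] that(2) by force
    then have "{v. x v \<noteq> 0} \<notin> \<Delta>"
      using abstract_complex_subset[OF \<Delta>] R(3) by blast
    then show ?thesis using that(1) by (auto simp: realization_def)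
  qed
  have sum_supp: "(\<Sum>v | x v \<noteq> 0. x v) = sum x \<sigma>" if "{v. x v \<noteq> 0} \<subseteq> \<sigma>" for x :: "'a \<Rightarrow> real"
    using that \<open>finite \<sigma>\<close> by (intro sum.mono_neutral_left) auto
  have path: "(\<lambda>v. (1 - t) * x v + t * r x v) \<in> ?X" (is "?y \<in> ?X")
    if x: "x \<in> ?X" and t: "0 \<le> t" "t \<le> 1" for x t
  proof (cases "m x = 0")
    case True
    then show ?thesis using x by (simp add: r_fix algebra_simps)
  next
    case False
    have y: "(1 - t) * x v + t * r x v = x v + t * m x * ((if v = w then real (card R) else 0) - (if v \<in> R then 1 else 0))" for v
      using w(2) by (auto simp: r_def algebra_simps)
    have nonneg: "0 \<le> r x v" for v
      using m_le[of v x] m_nonneg[OF x] x by (auto simp: r_def realization_def)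
    have "0 \<le> ?y v" for v
      using nonneg[of v] x t by (simp add: realization_def)
    moreover have sub: "{v. ?y v \<noteq> 0} \<subseteq> \<sigma>"
      using supp[OF x False] w(1) R(1) unfolding y by (auto split: if_splits)
    moreover have "sum ?y \<sigma> = 1"
    proof -
      have "(\<Sum>v\<in>\<sigma>. if v \<in> R then 1 else 0 :: real) = card R"
        using R(1) \<open>finite \<sigma>\<close> by (simp add: sum.If_cases Int_absorb1)
      then have "sum ?y \<sigma> = sum x \<sigma>"
        unfolding y using w(1) \<open>finite \<sigma>\<close>
        by (simp add: sum.distrib sum_subtractf sum_distrib_left[symmetric])
      also have "\<dots> = 1"
        using sum_supp[OF supp[OF x False]] x by (simp add: realization_def)
      finally show ?thesis .
    qed
    ultimately show ?thesis
      unfolding realization_def using sum_supp[OF sub] by auto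
  qed
  have r_Y: "r x \<in> ?Y" if x: "x \<in> ?X" for x
  proof -
    have rX: "r x \<in> ?X" using path[OF x, of 1] by simp
    obtain v where v: "v \<in> R" "x v = m x" using m_attained by blast
    have "{u. r x u \<noteq> 0} \<in> \<Delta>"
    proof (cases "{u. r x u \<noteq> 0} \<subseteq> \<sigma>")
      case True
      moreover have "r x v = 0" using v by (simp add: r_def)
      ultimately have "{u. r x u \<noteq> 0} \<subseteq> \<sigma> - {v}" by auto
      then show ?thesis
        using glue v(1) abstract_complex_subset[OF \<Delta>] by (auto simp: glues_along_def)
    next
      case False
      then show ?thesis using rX by (auto simp: realization_def)
    qed
    then show ?thesis using rX by (auto simp: realization_def)
  qed
  have coord: "continuous_on ?X (\<lambda>x. x v)" for v :: 'a
    by (rule continuous_on_product_then_coordinatewise[OF continuous_on_id])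
  have "continuous_on ?X m"
    unfolding m_def using continuous_on_Min[OF R(2) \<open>R \<noteq> {}\<close>, of ?X "\<lambda>v x. x v"] coord by simp
  then have "continuous_on ?X (\<lambda>x. r x v)" for v
    unfolding r_def
    by (cases "v \<in> R"; cases "v = w") (auto intro!: continuous_intros coord)
  then have cont: "continuous_on ?X r"
    by (rule continuous_on_coordinatewise_then_product)
  have id_r: "homotopic_with_canon (\<lambda>_. True) ?X ?X id r"
    using path by (intro homotopic_straight_line) (auto intro: continuous_on_id cont)
  obtain a where "homotopic_with_canon (\<lambda>_. True) ?Y ?Y id (\<lambda>_. a)"
    using contr by (auto simp: contractible_complex_def contractible_def)
  then have "homotopic_with_canon (\<lambda>_. True) ?X ?Y (id \<circ> r) ((\<lambda>_. a) \<circ> r)"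
    by (rule homotopic_with_compose_continuous_map_right[where p = "\<lambda>_. True"])
       (use cont r_Y in auto)
  then have "homotopic_with_canon (\<lambda>_. True) ?X ?X r (\<lambda>_. a)"
    unfolding o_def id_apply by (rule homotopic_with_subset_right) (auto simp: realization_def)
  from homotopic_with_trans[OF id_r this] show ?thesis
    unfolding contractible_complex_def contractible_def by blast
qed

lemma contractible_buildable_from:
  assumes "abstract_complex \<Delta>" "{} \<in> \<Delta>" "contractible_complex \<Delta>"
    and "\<And>\<sigma>. \<sigma> \<in> set \<sigma>s \<Longrightarrow> finite \<sigma>" "buildable \<Delta> \<sigma>s"
  shows "contractible_complex (\<Delta> \<union> generated (set \<sigma>s))"
  using assms
proof (induction \<sigma>s arbitrary: \<Delta>)
  case (Cons \<sigma> \<sigma>s)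
  obtain R where R: "glues_along \<Delta> \<sigma> R" using Cons.prems by auto
  then have "R \<noteq> {}" using Cons.prems(2) by (auto simp: glues_along_def)
  then have "contractible_complex (\<Delta> \<union> Pow \<sigma>)"
    using contractible_glue[OF Cons.prems(1) R] Cons.prems by simp
  then have "contractible_complex ((\<Delta> \<union> Pow \<sigma>) \<union> generated (set \<sigma>s))"
    using Cons.prems by (intro Cons.IH) (auto intro: abstract_complex_Un abstract_complex_Pow)
  then show ?case by (simp add: generated_insert Un_assoc)
qed simp

text \<open>
  The first facet has the empty restriction face, so it is not an elementary expansion; it is a simplex,
  from which the other facets are attached by expansions.
\<close>

lemma buildable_contractible:
  assumes "\<And>\<sigma>. \<sigma> \<in> set \<sigma>s \<Longrightarrow> finite \<sigma>" "buildable {} \<sigma>s" "\<sigma>s \<noteq> []"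
  shows "contractible_complex (generated (set \<sigma>s))"
proof -
  obtain \<sigma> \<tau>s where \<sigma>s: "\<sigma>s = \<sigma> # \<tau>s" using assms(3) by (cases \<sigma>s) auto
  have fin: "finite \<sigma>" using assms(1) \<sigma>s by simp
  have "\<exists>w. w \<in> \<sigma>" using assms(2) by (auto simp: \<sigma>s glues_along_def)
  then have "contractible_complex (Pow \<sigma>)"
    using contractible_simplex[OF fin] by blast
  then have "contractible_complex (Pow \<sigma> \<union> generated (set \<tau>s))"
    using assms(1,2) fin by (intro contractible_buildable_from) (auto simp: \<sigma>s abstract_complex_Pow)
  then show ?thesis by (simp add: \<sigma>s generated_insert)
qed

section \<open>A single blade\<close>

text \<open>
  The restriction faces are recorded next to the facets, so that each gluing condition becomes a finite
  check on explicit sets.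
\<close>

fun buildable_by :: "'a set set \<Rightarrow> ('a set \<times> 'a set) list \<Rightarrow> bool" where
  "buildable_by \<Delta> [] \<longleftrightarrow> True"
| "buildable_by \<Delta> ((\<sigma>, R) # ps) \<longleftrightarrow> glues_along \<Delta> \<sigma> R \<and> buildable_by (\<Delta> \<union> Pow \<sigma>) ps"

lemma buildable_by_imp_buildable: "buildable_by \<Delta> ps \<Longrightarrow> buildable \<Delta> (map fst ps)"
  by (induction \<Delta> ps rule: buildable_by.induct) auto

text \<open>
  A triangulated heptagon with boundary word \<open>c a p c p' a' p'\<close>, that is, the edge \<open>c a\<close>, then the path
  \<open>a p c\<close>, and then the path \<open>c p' a' p' c\<close>, which runs along \<open>c p' a'\<close> forth and back. The interior
  vertices are \<open>w x y z\<close>. For \<open>a = a'\<close>, \<open>p = p'\<close> this is a dunce hat with one free edge \<open>c a\<close>. Four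
  interior vertices suffice to give different faces of the heptagon different vertex sets, even after
  that identification, apart from the intended gluings.
\<close>

definition blade :: "'a \<Rightarrow> 'a \<Rightarrow> 'a \<Rightarrow> 'a \<Rightarrow> 'a \<Rightarrow> 'a \<Rightarrow> 'a \<Rightarrow> 'a \<Rightarrow> 'a \<Rightarrow> 'a set set" where
  "blade c a p a' p' w x y z =
     {{c, a, w}, {a, p, w}, {c, p, x}, {c, p', y}, {a', p', y}, {a', p', z}, {c, p', z},
      {p, w, x}, {c, x, y}, {a', y, z}, {c, z, w}, {w, x, y}, {w, y, z}}"

lemma glues_along_iff:
  "glues_along \<Delta> \<sigma> R \<longleftrightarrow> R \<subseteq> \<sigma> \<and> \<not> \<sigma> \<subseteq> R \<and> R \<notin> \<Delta> \<and> (\<forall>v\<in>R. \<sigma> - {v} \<in> \<Delta>)"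
  by (auto simp: glues_along_def)

text \<open>
  A blade is attached in three different situations, named by its place in the shelling of the turbine.
  The listed restriction faces are absent from the complex to which the blade is attached because each of
  them contains a vertex that is absent there, or is the tip edge; the empty one occurs only as the start
  from the void complex.

  The first blade grows from its tip edge, or from nothing if no tip edge was removed from the relative
  complex.
\<close>

lemma build_first_blade:
  assumes dist: "distinct [c, a, p, a', p', w, x, y, z]" and \<Delta>: "abstract_complex \<Delta>"
    and old: "\<Delta> = {} \<or> {c, a} \<in> \<Delta>"
    and fresh: "\<Union>\<Delta> \<inter> {p, a', p', w, x, y, z} = {}"
  shows "\<exists>\<sigma>s. set \<sigma>s = blade c a p a' p' w x y z \<and> buildable \<Delta> \<sigma>s"
proof -
  \<comment> \<open>Rewriting with the disequations needs both orientations.\<close>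
  have dist': "distinct [z, y, x, w, p', a', p, a, c]" using dist by auto
  let ?ps = "[({c, a, w}, if \<Delta> = {} then {} else {w}), ({a, p, w}, {p}), ({c, z, w}, {z}),
    ({w, y, z}, {y}), ({w, x, y}, {x}), ({p, w, x}, {p, x}), ({c, p', z}, {p'}),
    ({a', p', z}, {a'}), ({a', y, z}, {a', y}), ({a', p', y}, {p', y}), ({c, p', y}, {c, y}),
    ({c, x, y}, {c, x}), ({c, p, x}, {c, p})]"
  have new: "\<tau> \<notin> \<Delta>"
    if "p \<in> \<tau> \<or> a' \<in> \<tau> \<or> p' \<in> \<tau> \<or> w \<in> \<tau> \<or> x \<in> \<tau> \<or> y \<in> \<tau> \<or> z \<in> \<tau>" for \<tau>
    using fresh that by blast
  have sub: "\<Delta> = {} \<or> {} \<in> \<Delta> \<and> {c} \<in> \<Delta> \<and> {a} \<in> \<Delta> \<and> {c, a} \<in> \<Delta>"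
    using old abstract_complex_subset[OF \<Delta>, of "{c, a}"] by auto
  have "buildable_by \<Delta> ?ps"
  proof (cases "\<Delta> = {}")
    case True
    then show ?thesis using dist dist' by (simp add: glues_along_iff insert_Diff_if)
  next
    case False
    then show ?thesis using dist dist' sub by (simp add: glues_along_iff insert_Diff_if new)
  qed
  moreover have "set (map fst ?ps) = blade c a p a' p' w x y z"
    unfolding blade_def by (simp add: insert_commute)
  ultimately show ?thesis using buildable_by_imp_buildable by blast
qed

text \<open>
  A middle blade grows from the doubled path \<open>c p' a'\<close>, which is already there. The triangle
  \<open>c a w\<close> at the tip edge is added as soon as its side \<open>c w\<close> is present, and before any other triangle
  at \<open>a\<close>: then its new faces have a least element no matter whether the tip edge is old
  (\<open>{a, w}\<close>) or not (\<open>{a}\<close>).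
\<close>

lemma build_middle_blade:
  assumes dist: "distinct [c, a, p, a', p', w, x, y, z]" and \<Delta>: "abstract_complex \<Delta>"
    and old: "{c, p'} \<in> \<Delta>" "{a', p'} \<in> \<Delta>"
    and tip: "{c, a} \<in> \<Delta> \<or> a \<notin> \<Union>\<Delta>"
    and fresh: "\<Union>\<Delta> \<inter> {p, w, x, y, z} = {}"
  shows "\<exists>\<sigma>s. set \<sigma>s = blade c a p a' p' w x y z \<and> buildable \<Delta> \<sigma>s"
proof -
  have dist': "distinct [z, y, x, w, p', a', p, a, c]" using dist by auto
  let ?ps = "[({c, p', y}, {y}), ({a', p', y}, {a', y}), ({a', y, z}, {z}), ({a', p', z}, {p', z}),
    ({c, p', z}, {c, z}), ({w, y, z}, {w}), ({c, z, w}, {c, w}),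
    ({c, a, w}, if {c, a} \<in> \<Delta> then {a, w} else {a}), ({a, p, w}, {p}), ({c, x, y}, {x}),
    ({w, x, y}, {w, x}), ({p, w, x}, {p, x}), ({c, p, x}, {c, p})]"
  have new: "\<tau> \<notin> \<Delta>"
    if "p \<in> \<tau> \<or> w \<in> \<tau> \<or> x \<in> \<tau> \<or> y \<in> \<tau> \<or> z \<in> \<tau>" for \<tau>
    using fresh that by blast
  have sub: "{} \<in> \<Delta>" "{c} \<in> \<Delta>" "{a'} \<in> \<Delta>" "{p'} \<in> \<Delta>"
    using abstract_complex_subset[OF \<Delta> old(1)] abstract_complex_subset[OF \<Delta> old(2)] by auto
  have "buildable_by \<Delta> ?ps"
  proof (cases "{c, a} \<in> \<Delta>")
    case True
    moreover have "{a} \<in> \<Delta>" using abstract_complex_subset[OF \<Delta> True] by auto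
    ultimately show ?thesis
      using dist dist' old sub by (simp add: glues_along_iff insert_Diff_if new)
  next
    case False
    then have "{a} \<notin> \<Delta>" using tip by auto
    with False show ?thesis
      using dist dist' old sub by (simp add: glues_along_iff insert_Diff_if new)
  qed
  moreover have "set (map fst ?ps) = blade c a p a' p' w x y z"
    unfolding blade_def by (simp add: insert_commute)
  ultimately show ?thesis using buildable_by_imp_buildable by blast
qed

text \<open>
  For the last blade all of the boundary but the tip edge is old; the tip edge is the restriction face
  of the final triangle.
\<close>

lemma build_last_blade:
  assumes dist: "distinct [c, a, p, a', p', w, x, y, z]" and \<Delta>: "abstract_complex \<Delta>"
    and old: "{c, p'} \<in> \<Delta>" "{a', p'} \<in> \<Delta>" "{c, p} \<in> \<Delta>" "{a, p} \<in> \<Delta>"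
    and tip: "{c, a} \<notin> \<Delta>"
    and fresh: "\<Union>\<Delta> \<inter> {w, x, y, z} = {}"
  shows "\<exists>\<sigma>s. set \<sigma>s = blade c a p a' p' w x y z \<and> buildable \<Delta> \<sigma>s"
proof -
  have dist': "distinct [z, y, x, w, p', a', p, a, c]" using dist by auto
  let ?ps = "[({c, p', y}, {y}), ({a', p', y}, {a', y}), ({a', y, z}, {z}), ({a', p', z}, {p', z}),
    ({c, p', z}, {c, z}), ({w, y, z}, {w}), ({c, z, w}, {c, w}), ({c, x, y}, {x}),
    ({w, x, y}, {w, x}), ({c, p, x}, {p, x}), ({p, w, x}, {p, w}), ({a, p, w}, {a, w}),
    ({c, a, w}, {c, a})]"
  have new: "\<tau> \<notin> \<Delta>" if "w \<in> \<tau> \<or> x \<in> \<tau> \<or> y \<in> \<tau> \<or> z \<in> \<tau>" for \<tau>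
    using fresh that by blast
  have sub: "{} \<in> \<Delta>" "{c} \<in> \<Delta>" "{a'} \<in> \<Delta>" "{p'} \<in> \<Delta>" "{a} \<in> \<Delta>" "{p} \<in> \<Delta>"
    using abstract_complex_subset[OF \<Delta> old(1)] abstract_complex_subset[OF \<Delta> old(2)]
      abstract_complex_subset[OF \<Delta> old(4)] by auto
  have "buildable_by \<Delta> ?ps"
    using dist dist' old sub tip by (simp add: glues_along_iff insert_Diff_if new)
  moreover have "set (map fst ?ps) = blade c a p a' p' w x y z"
    unfolding blade_def by (simp add: insert_commute)
  ultimately show ?thesis using buildable_by_imp_buildable by blast
qed

text \<open>
  For \<open>n = 1\<close> the only blade is glued to itself. The order of the last blade works from scratch, because
  its first two triangles put the path \<open>c p a\<close> in place.
\<close>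

lemma build_closed_blade:
  assumes dist: "distinct [c, a, p, w, x, y, z]"
  shows "\<exists>\<sigma>s. set \<sigma>s = blade c a p a p w x y z \<and> buildable {} \<sigma>s"
proof -
  have dist': "distinct [z, y, x, w, p, a, c]" using dist by auto
  let ?ps = "[({c, p, y}, {}), ({a, p, y}, {a}), ({a, y, z}, {z}), ({a, p, z}, {p, z}),
    ({c, p, z}, {c, z}), ({w, y, z}, {w}), ({c, z, w}, {c, w}), ({c, x, y}, {x}),
    ({w, x, y}, {w, x}), ({c, p, x}, {p, x}), ({p, w, x}, {p, w}), ({a, p, w}, {a, w}),
    ({c, a, w}, {c, a})]"
  have "buildable_by {} ?ps"
    using dist dist' by (simp add: glues_along_iff insert_Diff_if)
  moreover have "set (map fst ?ps) = blade c a p a p w x y z"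
    unfolding blade_def by (simp add: insert_commute)
  ultimately show ?thesis using buildable_by_imp_buildable by blast
qed

lemma Union_blade: "\<Union>(blade c a p a' p' w x y z) = {c, a, p, a', p', w, x, y, z}"
  unfolding blade_def by auto

text \<open>
  An interior edge has a triangle on each side, and an edge of the doubled path \<open>c p' a'\<close> has those of its
  two traversals. This leaves the boundary edges that are traversed once. The lemma also covers the
  blade that is glued to itself, where \<open>a = a'\<close> and \<open>p = p'\<close>.
\<close>

lemma blade_ridge:
  assumes "distinct [c, a, p, w, x, y, z]" "a' \<noteq> p'" "{a', p'} \<inter> {c, w, x, y, z} = {}"
  shows "\<forall>\<sigma>\<in>blade c a p a' p' w x y z. \<forall>v\<in>\<sigma>.
    \<sigma> - {v} \<subseteq> {c, a} \<or> \<sigma> - {v} \<subseteq> {a, p} \<or> \<sigma> - {v} \<subseteq> {c, p} \<or>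
    (\<exists>\<sigma>'\<in>blade c a p a' p' w x y z. v \<notin> \<sigma>' \<and> \<sigma> - {v} \<subseteq> \<sigma>')"
proof -
  have "distinct [z, y, x, w, p, a, c]" "{c, w, x, y, z} \<inter> {a', p'} = {}" "p' \<noteq> a'"
    "a' \<notin> {c, w, x, y, z}" "p' \<notin> {c, w, x, y, z}"
    using assms by auto
  with assms show ?thesis unfolding blade_def by (simp add: insert_Diff_if)
qed

section \<open>The turbine\<close>

text \<open>
  The hub is the number \<open>0\<close>; blade \<open>j\<close> owns its tip \<open>vertex 0 j\<close>, the midpoint \<open>vertex 1 j\<close> of the path
  from the tip back to the hub, and its interior vertices \<open>vertex 2 j\<close> to \<open>vertex 5 j\<close>.
\<close>

definition vertex :: "nat \<Rightarrow> nat \<Rightarrow> nat" where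
  "vertex k j = Suc (prod_encode (k, j))"

lemma vertex_eq_iff [simp]: "vertex k i = vertex l j \<longleftrightarrow> k = l \<and> i = j"
  by (simp add: vertex_def prod_encode_eq)

lemma vertex_neq_0 [simp]: "vertex k j \<noteq> 0" "0 \<noteq> vertex k j"
  by (simp_all add: vertex_def)

definition blade_at :: "nat \<Rightarrow> nat \<Rightarrow> nat set set" where
  "blade_at i j = blade 0 (vertex 0 i) (vertex 1 i) (vertex 0 j) (vertex 1 j)
     (vertex 2 i) (vertex 3 i) (vertex 4 i) (vertex 5 i)"

definition turbine_triangles :: "nat \<Rightarrow> nat set set" where
  "turbine_triangles n = (\<Union>j<n. blade_at j (Suc j mod n))"

definition tip_edge :: "nat \<Rightarrow> nat set" where
  "tip_edge j = {0, vertex 0 j}"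

lemma tip_edge_eq_iff [simp]: "tip_edge i = tip_edge j \<longleftrightarrow> i = j"
  by (auto simp: tip_edge_def doubleton_eq_iff)

lemma blade_at_finite: "finite (blade_at i j)"
  by (simp add: blade_at_def blade_def)

lemma blade_at_card: "\<sigma> \<in> blade_at i j \<Longrightarrow> finite \<sigma> \<and> card \<sigma> = 3"
  unfolding blade_at_def blade_def by (elim insertE emptyE; simp)

lemma blade_at_subset: "j < n \<Longrightarrow> blade_at j (Suc j mod n) \<subseteq> turbine_triangles n"
  unfolding turbine_triangles_def by (rule UN_upper) simp

lemma turbine_triangles_finite: "finite (turbine_triangles n)"
  by (simp add: turbine_triangles_def blade_at_finite)

lemma turbine_triangles_card: "\<sigma> \<in> turbine_triangles n \<Longrightarrow> finite \<sigma> \<and> card \<sigma> = 3"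
  using blade_at_card by (auto simp: turbine_triangles_def)

lemma abstract_complex_turbine: "abstract_complex (generated (turbine_triangles n))"
  using turbine_triangles_card turbine_triangles_finite by (intro abstract_complex_generated) auto

text \<open>
  The triangles at the far end of the doubled path of a blade avoid the hub.
\<close>

lemma tip_edge_subset_blade_at:
  assumes "\<sigma> \<in> blade_at i j" "tip_edge k \<subseteq> \<sigma>"
  shows "k = i \<and> \<sigma> = {0, vertex 0 i, vertex 2 i}"
  using assms unfolding blade_at_def blade_def tip_edge_def by (elim insertE emptyE; simp)

lemma path_edges_in_blade_at:
  "{0, vertex 1 i} \<in> generated (blade_at i j)" "{vertex 0 i, vertex 1 i} \<in> generated (blade_at i j)"
  "{0, vertex 1 j} \<in> generated (blade_at i j)" "{vertex 0 j, vertex 1 j} \<in> generated (blade_at i j)"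
  by (simp_all add: generated_def blade_at_def blade_def)

lemma Union_blade_at:
  "v \<in> \<Union>(blade_at i j) \<longleftrightarrow> v = 0 \<or> v = vertex 0 j \<or> v = vertex 1 j \<or> (\<exists>k<6. v = vertex k i)"
proof -
  have "(\<exists>k<6. v = vertex k i) \<longleftrightarrow> v = vertex 0 i \<or> v = vertex 1 i \<or> v = vertex 2 i \<or>
      v = vertex 3 i \<or> v = vertex 4 i \<or> v = vertex 5 i"
    by (simp add: numeral_eq_Suc less_Suc_eq ex_disj_distrib conj_disj_distribR)
  then show ?thesis unfolding blade_at_def Union_blade by blast
qed

lemma Union_generated: "\<Union>(generated S) = \<Union>S"
  by (auto simp: generated_def)

section \<open>Relative shellings of the turbine\<close>

text \<open>
  The blades are attached in the cyclic order \<open>j, j - 1, \<dots>, j + 1\<close>. Each blade after the first finds its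
  doubled path in place, as that path belongs to the preceding blade of this order. Blade \<open>j\<close> may use
  its own tip edge as a start, and blade \<open>j + 1\<close>, whose undoubled path has been covered by blade \<open>j\<close>,
  closes up at its tip edge, which is required to be new.
\<close>

lemma buildable_turbine:
  assumes "2 \<le> n" "E \<subseteq> tip_edge ` {..<n}" "E = {} \<or> tip_edge j \<in> E"
    and j: "j < n" "tip_edge (Suc j mod n) \<notin> E"
  shows "\<exists>\<sigma>s. set \<sigma>s = turbine_triangles n \<and> buildable (generated E) \<sigma>s"
proof -
  \<comment> \<open>Renumbered by \<open>u\<close>, the blades are attached from \<open>n - 1\<close> down to \<open>0\<close>, and the cyclic
    structure is visible only in \<open>u n = u 0\<close>.\<close>
  define u where "u m = (Suc j + m) mod n" for m
  define B where "B m = blade_at (u m) (u (Suc m))" for m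
  define S where "S k = (\<Union>m\<in>{k..<n}. B m)" for k
  have u_neq: "u l \<noteq> u m" if "l < m" "m < n" for l m
  proof
    assume "u l = u m"
    then have "n dvd (Suc j + m) - (Suc j + l)"
      unfolding u_def using that(1) by (subst mod_eq_dvd_iff_nat[symmetric]) auto
    then show False using that by (auto dest: dvd_imp_le)
  qed
  have u_inj: "u l = u m \<longleftrightarrow> l = m" if "l < n" "m < n" for l m
    using u_neq[of l m] u_neq[of m l] that by (cases l m rule: linorder_cases) auto
  have u_n: "u n = u 0" unfolding u_def by (simp only: mod_add_self2 add_0_right)
  have u_last: "u (n - 1) = j"
  proof -
    have "Suc j + (n - 1) = j + n" using assms(1) by simp
    then show ?thesis using j(1) by (simp add: u_def)
  qed
  have u_0: "u 0 = Suc j mod n" by (simp add: u_def)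
  have u_less: "u m < n" for m using assms(1) by (simp add: u_def)
  have B_eq: "B m = blade_at (u m) (Suc (u m) mod n)" for m
    by (simp add: B_def u_def mod_Suc_eq)
  have "u ` {..<n} = {..<n}"
    by (rule card_subset_eq) (auto simp: u_less card_image inj_on_def u_inj)
  then have "turbine_triangles n = (\<Union>j\<in>u ` {..<n}. blade_at j (Suc j mod n))"
    by (simp only: turbine_triangles_def)
  then have S_0: "S 0 = turbine_triangles n"
    by (simp add: S_def B_eq atLeast0LessThan)
  let ?E = "generated E"
  have E: "abstract_complex ?E"
    using assms(2) by (intro abstract_complex_generated) (auto simp: tip_edge_def dest: finite_subset)
  have E_vertices: "v = 0 \<or> (\<exists>m. v = vertex 0 m \<and> tip_edge m \<in> E)" if "v \<in> \<Union>?E" for v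
    using that assms(2) by (auto simp: Union_generated tip_edge_def)
  have E_tip: "tip_edge m \<in> ?E \<longleftrightarrow> tip_edge m \<in> E" for m
    using assms(2) by (auto simp: generated_def tip_edge_def)
  have S_finite: "finite (S k)" "\<sigma> \<in> S k \<Longrightarrow> finite \<sigma>" for k \<sigma>
    using blade_at_card by (auto simp: S_def B_def blade_at_finite)
  have complex: "abstract_complex (?E \<union> generated (S k))" for k
    using S_finite by (intro abstract_complex_Un[OF E] abstract_complex_generated)
  have vertices: "v = 0 \<or> (\<exists>m. v = vertex 0 m \<and> tip_edge m \<in> E) \<or>
      (\<exists>m\<in>{k..<n}. v = vertex 0 (u (Suc m)) \<or> v = vertex 1 (u (Suc m)) \<or> (\<exists>i<6. v = vertex i (u m)))"
    if "v \<in> \<Union>(?E \<union> generated (S k))" for v k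
  proof -
    have "v \<in> \<Union>?E \<or> (\<exists>m\<in>{k..<n}. v \<in> \<Union>(B m))"
      using that unfolding Union_Un_distrib Union_generated S_def by blast
    then show ?thesis
    proof (elim disjE bexE)
      fix m assume "m \<in> {k..<n}" "v \<in> \<Union>(B m)"
      then show ?thesis unfolding B_def Union_blade_at by metis
    qed (use E_vertices in blast)
  qed
  have u_Suc: "u (Suc m) \<noteq> u k" if "0 < k" "k \<le> m" "m < n" for m k
    using that u_inj[of "Suc m" k] u_inj[of 0 k] u_n by (cases "Suc m = n") auto
  have S_Suc: "S k = B k \<union> S (Suc k)" if "k < n" for k
  proof -
    have "{k..<n} = insert k {Suc k..<n}" using that by auto
    then show ?thesis by (simp add: S_def)
  qed
  have B_S: "B m \<subseteq> S k" if "k \<le> m" "m < n" for k m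
    unfolding S_def by (rule UN_upper) (simp add: that)
  have attach: "\<exists>\<sigma>s. set \<sigma>s = S k \<and> buildable ?E \<sigma>s"
    if k: "k < n" "set \<sigma>s = S (Suc k)" "buildable ?E \<sigma>s"
      and \<tau>s: "\<exists>\<tau>s. set \<tau>s = B k \<and> buildable (?E \<union> generated (S (Suc k))) \<tau>s" for k \<sigma>s
  proof -
    obtain \<tau>s where "set \<tau>s = B k" "buildable (?E \<union> generated (S (Suc k))) \<tau>s"
      using \<tau>s by blast
    then have "set (\<sigma>s @ \<tau>s) = S k \<and> buildable ?E (\<sigma>s @ \<tau>s)"
      using k by (auto simp: buildable_append S_Suc)
    then show ?thesis by blast
  qed
  have "\<exists>\<sigma>s. set \<sigma>s = S 1 \<and> buildable ?E \<sigma>s"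
  proof (rule inc_induct[of 1 "n - 1"])
    show "1 \<le> n - 1" using assms(1) by simp
    have "u (n - 1) \<noteq> u 0" using u_inj assms(1) by simp
    moreover have "?E = {} \<or> tip_edge (u (n - 1)) \<in> ?E"
      using assms(3) E_tip u_last by auto
    moreover have "\<Union>?E \<inter> {vertex 1 (u (n - 1)), vertex 0 (u 0), vertex 1 (u 0), vertex 2 (u (n - 1)),
        vertex 3 (u (n - 1)), vertex 4 (u (n - 1)), vertex 5 (u (n - 1))} = {}"
      using E_vertices j(2) u_0 by fastforce
    ultimately have "\<exists>\<tau>s. set \<tau>s = B (n - 1) \<and> buildable ?E \<tau>s"
      unfolding B_def blade_at_def using assms(1) E
      by (intro build_first_blade) (simp_all add: u_n tip_edge_def)
    then show "\<exists>\<sigma>s. set \<sigma>s = S (n - 1) \<and> buildable ?E \<sigma>s"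
      using attach[of "n - 1" "[]"] assms(1) by (simp add: S_def)
  next
    fix k assume k: "1 \<le> k" "k < n - 1" and IH: "\<exists>\<sigma>s. set \<sigma>s = S (Suc k) \<and> buildable ?E \<sigma>s"
    let ?\<Delta> = "?E \<union> generated (S (Suc k))"
    have "B (Suc k) \<subseteq> S (Suc k)" by (rule B_S) (use k in auto)
    from generated_mono[OF this] have "{0, vertex 1 (u (Suc k))} \<in> ?\<Delta>" "{vertex 0 (u (Suc k)), vertex 1 (u (Suc k))} \<in> ?\<Delta>"
      using path_edges_in_blade_at unfolding B_def by blast+
    moreover have "u (Suc k) \<noteq> u k" using u_Suc[of k k] k by simp
    moreover have new: "u m \<noteq> u k \<and> u (Suc m) \<noteq> u k" if "m \<in> {Suc k..<n}" for m
      using that u_inj[of m k] u_Suc[of k m] k by simp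
    have "vertex i (u k) \<notin> \<Union>?\<Delta>" if "0 < i \<or> tip_edge (u k) \<notin> E" for i
    proof
      assume "vertex i (u k) \<in> \<Union>?\<Delta>"
      from vertices[OF this] that have "\<exists>m\<in>{Suc k..<n}. u k = u (Suc m) \<or> u k = u m" by auto
      then show False using new by metis
    qed
    then have "{0, vertex 0 (u k)} \<in> ?\<Delta> \<or> vertex 0 (u k) \<notin> \<Union>?\<Delta>"
      and "\<Union>?\<Delta> \<inter> {vertex 1 (u k), vertex 2 (u k), vertex 3 (u k), vertex 4 (u k), vertex 5 (u k)} = {}"
      using E_tip[of "u k"] by (auto simp: tip_edge_def simp del: Union_Un_distrib)
    ultimately have "\<exists>\<tau>s. set \<tau>s = B k \<and> buildable ?\<Delta> \<tau>s"
      unfolding B_def blade_at_def using complex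
      by (intro build_middle_blade) simp_all
    then show "\<exists>\<sigma>s. set \<sigma>s = S k \<and> buildable ?E \<sigma>s"
      using attach[of k] IH k by auto
  qed
  moreover have "\<exists>\<tau>s. set \<tau>s = B 0 \<and> buildable (?E \<union> generated (S 1)) \<tau>s"
  proof -
    let ?\<Delta> = "?E \<union> generated (S 1)"
    have "B 1 \<subseteq> S 1" "B (n - 1) \<subseteq> S 1" using B_S assms(1) by auto
    from this[THEN generated_mono] have "{0, vertex 1 (u 1)} \<in> ?\<Delta>" "{vertex 0 (u 1), vertex 1 (u 1)} \<in> ?\<Delta>"
      "{0, vertex 1 (u 0)} \<in> ?\<Delta>" "{vertex 0 (u 0), vertex 1 (u 0)} \<in> ?\<Delta>"
      using path_edges_in_blade_at(1,2)[of "u 1" "u (Suc 1)"]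
        path_edges_in_blade_at(3,4)[of "u 0" "u (n - 1)"] assms(1) unfolding B_def by (auto simp: u_n)
    moreover have "u 1 \<noteq> u 0" using u_inj assms(1) by simp
    moreover have tip: "tip_edge (u 0) \<notin> ?\<Delta>"
    proof
      assume "tip_edge (u 0) \<in> ?\<Delta>"
      then have "tip_edge (u 0) \<in> generated (S 1)"
        using E_tip[of "u 0"] u_0 j(2) by simp
      then obtain \<sigma> where \<sigma>: "\<sigma> \<in> S 1" "tip_edge (u 0) \<subseteq> \<sigma>"
        unfolding generated_def by blast
      then obtain m where m: "m \<in> {1..<n}" "\<sigma> \<in> B m" unfolding S_def by blast
      then have "u 0 = u m"
        using tip_edge_subset_blade_at[of \<sigma>] \<sigma>(2) unfolding B_def by blast
      then show False using u_inj[of 0 m] m(1) by simp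
    qed
    moreover have "vertex i (u 0) \<notin> \<Union>?\<Delta>" if "1 < i" for i
    proof
      assume "vertex i (u 0) \<in> \<Union>?\<Delta>"
      from vertices[OF this] show False using u_inj[of 0] that by auto
    qed
    then have "\<Union>?\<Delta> \<inter> {vertex 2 (u 0), vertex 3 (u 0), vertex 4 (u 0), vertex 5 (u 0)} = {}"
      by (auto simp del: Union_Un_distrib)
    ultimately show ?thesis
      unfolding B_def blade_at_def using complex
      by (intro build_last_blade) (simp_all add: tip_edge_def)
  qed
  ultimately show ?thesis
    using attach[of 0] assms(1) S_0 by auto
qed

text \<open>
  Since \<open>E\<close> is proper, a nonempty \<open>E\<close> contains some tip edge whose cyclic successor is missing; the
  shelling starts at the blade of the former and ends at that of the latter.
\<close>

lemma buildable_turbine_relative: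
  assumes "1 \<le> n" "E \<subset> tip_edge ` {..<n}"
  shows "\<exists>\<sigma>s. set \<sigma>s = turbine_triangles n \<and> buildable (generated E) \<sigma>s"
proof (cases "n = 1")
  case True
  then have "E = {}" using assms(2) by auto
  moreover have "turbine_triangles n = blade_at 0 0" using True by (simp add: turbine_triangles_def lessThan_Suc)
  moreover have "\<exists>\<sigma>s. set \<sigma>s = blade_at 0 0 \<and> buildable {} \<sigma>s"
    unfolding blade_at_def by (rule build_closed_blade) simp
  ultimately show ?thesis by simp
next
  case False
  then have n: "2 \<le> n" using assms(1) by simp
  have "\<exists>j<n. (E = {} \<or> tip_edge j \<in> E) \<and> tip_edge (Suc j mod n) \<notin> E"
  proof (cases "E = {}")
    case True
    then show ?thesis using assms(1) by (intro exI[of _ 0]) simp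
  next
    case False
    show ?thesis
    proof (rule ccontr)
      assume "\<not> ?thesis"
      then have step: "tip_edge (Suc j mod n) \<in> E" if "j < n" "tip_edge j \<in> E" for j
        using that by blast
      obtain j where j: "j < n" "tip_edge j \<in> E" using False assms(2) by blast
      have all: "tip_edge ((j + m) mod n) \<in> E" for m
      proof (induction m)
        case (Suc m)
        then show ?case using step[of "(j + m) mod n"] n by (simp add: mod_Suc_eq)
      qed (use j in simp)
      have "tip_edge i \<in> E" if "i < n" for i
        using all[of "n - j + i"] that j(1) by simp
      then show False using assms(2) by blast
    qed
  qed
  then show ?thesis using buildable_turbine[OF n] assms(2) by blast
qed

section \<open>Free faces of the turbine\<close>

text \<open>
  By \<open>blade_ridge\<close>, only the faces of the path \<open>a p c\<close> of a blade need an argument involving other blades.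
  The path from the tip of blade \<open>j\<close> to the hub occurs once in the boundary of blade \<open>j\<close>, but is the doubled
  path of the preceding blade \<open>?r\<close>, where two triangles lie on each of its edges.
\<close>

lemma two_triangles_of_nonfree_face:
  assumes \<sigma>: "\<sigma> \<in> turbine_triangles n" and \<tau>: "\<tau> \<subset> \<sigma>" "\<tau> \<noteq> {}" "\<tau> \<notin> tip_edge ` {..<n}"
  shows "\<exists>\<sigma>1\<in>turbine_triangles n. \<exists>\<sigma>2\<in>turbine_triangles n. \<sigma>1 \<noteq> \<sigma>2 \<and> \<tau> \<subset> \<sigma>1 \<and> \<tau> \<subset> \<sigma>2"
proof -
  have card_\<tau>: "card \<tau> < 3"
    using \<tau>(1) turbine_triangles_card[OF \<sigma>] psubset_card_mono by metis
  have proper: "\<tau> \<subset> \<rho>" if "\<rho> \<in> turbine_triangles n" "\<tau> \<subseteq> \<rho>" for \<rho>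
    using that card_\<tau> turbine_triangles_card[of \<rho>] by auto
  have *: ?thesis if "\<sigma>1 \<in> turbine_triangles n" "\<sigma>2 \<in> turbine_triangles n" "\<tau> \<subseteq> \<sigma>1 \<inter> \<sigma>2"
      "v \<in> \<sigma>1" "v \<notin> \<sigma>2" for \<sigma>1 \<sigma>2 v
    using that proper by (metis le_inf_iff)
  obtain j where j: "j < n" "\<sigma> \<in> blade_at j (Suc j mod n)"
    using \<sigma> by (auto simp: turbine_triangles_def)
  let ?s = "Suc j mod n" and ?r = "(j + (n - 1)) mod n"
  have "Suc ?r mod n = Suc (j + (n - 1)) mod n" by (rule mod_Suc_eq)
  also have "\<dots> = (j + n) mod n" using j(1) by simp
  also have "\<dots> = j" using j(1) by simp
  finally have r: "Suc ?r mod n = j" .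
  have "?r < n" using j(1) by simp
  from blade_at_subset[OF j(1)] blade_at_subset[OF this]
  have sub: "blade_at j ?s \<subseteq> turbine_triangles n" "blade_at ?r j \<subseteq> turbine_triangles n"
    unfolding r .
  obtain v where v: "v \<in> \<sigma>" "v \<notin> \<tau>" using \<tau>(1) by blast
  have \<tau>_sub: "\<tau> \<subseteq> \<sigma> - {v}" using \<tau>(1) v by blast
  have "\<forall>\<sigma>\<in>blade_at j ?s. \<forall>v\<in>\<sigma>. \<sigma> - {v} \<subseteq> {0, vertex 0 j} \<or> \<sigma> - {v} \<subseteq> {vertex 0 j, vertex 1 j} \<or>
      \<sigma> - {v} \<subseteq> {0, vertex 1 j} \<or> (\<exists>\<sigma>'\<in>blade_at j ?s. v \<notin> \<sigma>' \<and> \<sigma> - {v} \<subseteq> \<sigma>')"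
    unfolding blade_at_def by (rule blade_ridge) simp_all
  then consider (tip) "\<sigma> - {v} \<subseteq> {0, vertex 0 j}" | (ap) "\<sigma> - {v} \<subseteq> {vertex 0 j, vertex 1 j}"
    | (cp) "\<sigma> - {v} \<subseteq> {0, vertex 1 j}" | (ridge) \<sigma>' where "\<sigma>' \<in> blade_at j ?s" "v \<notin> \<sigma>'" "\<sigma> - {v} \<subseteq> \<sigma>'"
    using j(2) v(1) by meson
  then show ?thesis
  proof cases
    case tip
    then have "\<tau> \<subseteq> {0, vertex 0 j}" using \<tau>_sub by blast
    moreover have "\<tau> \<noteq> {0, vertex 0 j}" using \<tau>(3) j(1) by (auto simp: tip_edge_def)
    ultimately consider "\<tau> \<subseteq> {0}" | "\<tau> \<subseteq> {vertex 0 j}" by auto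
    then show ?thesis
    proof cases
      case 1
      show ?thesis
        by (rule *[of "{0, vertex 0 j, vertex 2 j}" "{0, vertex 1 j, vertex 3 j}" "vertex 2 j"])
           (use 1 sub in \<open>auto simp: blade_at_def blade_def\<close>)
    next
      case 2
      show ?thesis
        by (rule *[of "{0, vertex 0 j, vertex 2 j}" "{vertex 0 j, vertex 1 j, vertex 2 j}" 0])
           (use 2 sub in \<open>auto simp: blade_at_def blade_def\<close>)
    qed
  next
    case ap
    show ?thesis
      by (rule *[of "{vertex 0 j, vertex 1 j, vertex 4 ?r}" "{vertex 0 j, vertex 1 j, vertex 5 ?r}" "vertex 4 ?r"])
         (use ap \<tau>_sub sub in \<open>auto simp: blade_at_def blade_def\<close>)
  next
    case cp
    show ?thesis
      by (rule *[of "{0, vertex 1 j, vertex 4 ?r}" "{0, vertex 1 j, vertex 5 ?r}" "vertex 4 ?r"])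
         (use cp \<tau>_sub sub in \<open>auto simp: blade_at_def blade_def\<close>)
  next
    case ridge
    have "\<sigma>' \<in> turbine_triangles n" using ridge(1) sub(1) by blast
    moreover have "\<tau> \<subseteq> \<sigma> \<inter> \<sigma>'" using ridge(3) \<tau>_sub by blast
    ultimately show ?thesis using *[OF \<sigma> _ _ v(1) ridge(2)] by simp
  qed
qed

lemma facets_turbine: "facets (generated (turbine_triangles n)) = turbine_triangles n"
  using turbine_triangles_card by (rule facets_generated)

lemma tip_edges_in_turbine: "tip_edge ` {..<n} \<subseteq> generated (turbine_triangles n)"
proof
  fix e assume "e \<in> tip_edge ` {..<n}"
  then obtain j where "j < n" "e = tip_edge j" by blast
  then show "e \<in> generated (turbine_triangles n)"
    by (auto simp: generated_def turbine_triangles_def blade_at_def blade_def tip_edge_def)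
qed

lemma free_faces_turbine: "free_faces (generated (turbine_triangles n)) = tip_edge ` {..<n}"
proof
  show "free_faces (generated (turbine_triangles n)) \<subseteq> tip_edge ` {..<n}"
  proof
    fix \<tau> assume "\<tau> \<in> free_faces (generated (turbine_triangles n))"
    then have "\<tau> \<noteq> {}" and uniq: "\<exists>!\<sigma>. \<sigma> \<in> turbine_triangles n \<and> \<tau> \<subset> \<sigma>"
      by (simp_all add: free_faces_def facets_turbine)
    then show "\<tau> \<in> tip_edge ` {..<n}"
      using two_triangles_of_nonfree_face by metis
  qed
  show "tip_edge ` {..<n} \<subseteq> free_faces (generated (turbine_triangles n))"
  proof
    fix e assume e: "e \<in> tip_edge ` {..<n}"
    then obtain j where j: "j < n" "e = tip_edge j" by blast
    let ?t = "{0, vertex 0 j, vertex 2 j}"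
    have "vertex 2 j \<notin> e" "e \<subseteq> ?t"
      using j(2) by (auto simp: tip_edge_def)
    then have sub: "e \<subset> ?t" by blast
    have "?t \<in> blade_at j (Suc j mod n)"
      by (simp add: blade_at_def blade_def)
    then have mem: "?t \<in> turbine_triangles n"
      using blade_at_subset[OF j(1)] by blast
    have uniq: "\<sigma> = ?t" if \<sigma>: "\<sigma> \<in> turbine_triangles n" "e \<subset> \<sigma>" for \<sigma>
    proof -
      obtain i where "\<sigma> \<in> blade_at i (Suc i mod n)"
        using \<sigma>(1) unfolding turbine_triangles_def by blast
      then show ?thesis using tip_edge_subset_blade_at[of \<sigma> i _ j] \<sigma>(2) j(2) by blast
    qed
    have "\<exists>!\<sigma>. \<sigma> \<in> turbine_triangles n \<and> e \<subset> \<sigma>"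
      by (rule ex1I[of _ ?t]) (use mem sub in blast, erule conjE, rule uniq)
    then show "e \<in> free_faces (generated (turbine_triangles n))"
      using e tip_edges_in_turbine by (auto simp: free_faces_def facets_turbine tip_edge_def)
  qed
qed

lemma free_edges_turbine: "free_edges (generated (turbine_triangles n)) = tip_edge ` {..<n}"
  using tip_edges_in_turbine by (auto simp: free_edges_def free_faces_turbine edges_def face_dim_def tip_edge_def)

section \<open>The star of the tip edges\<close>

lemma tip_edge_card: "e \<in> tip_edge ` J \<Longrightarrow> finite e \<and> card e = 2"
  by (auto simp: tip_edge_def)

lemma buildable_star: "buildable {} (map tip_edge [0..<n])"
proof (induction n)
  case (Suc n)
  have "\<exists>R. glues_along (generated (tip_edge ` {0..<n})) (tip_edge n) R"
  proof (cases "n = 0")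
    case True
    then show ?thesis by (intro exI[of _ "{}"]) (auto simp: glues_along_def tip_edge_def)
  next
    case False
    have "{0} \<in> generated (tip_edge ` {0..<n})"
      using False by (intro mem_generatedI[of _ "tip_edge 0"]) (auto simp: tip_edge_def)
    moreover have "{vertex 0 n} \<notin> generated (tip_edge ` {0..<n})"
      by (auto simp: generated_def tip_edge_def)
    ultimately have "glues_along (generated (tip_edge ` {0..<n})) (tip_edge n) {vertex 0 n}"
      by (simp add: glues_along_iff tip_edge_def insert_Diff_if)
    then show ?thesis by blast
  qed
  then show ?case using Suc by (simp add: buildable_append)
qed simp

lemma edges_star: "edges (generated (tip_edge ` J)) = tip_edge ` J"
proof
  show "edges (generated (tip_edge ` J)) \<subseteq> tip_edge ` J"
  proof
    fix e assume "e \<in> edges (generated (tip_edge ` J))"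
    then obtain \<sigma> where "\<sigma> \<in> tip_edge ` J" "e \<subseteq> \<sigma>" "card e = 2"
      by (auto simp: edges_def generated_def face_dim_def)
    then show "e \<in> tip_edge ` J"
      using tip_edge_card[of \<sigma> J] by (metis card_subset_eq)
  qed
  show "tip_edge ` J \<subseteq> edges (generated (tip_edge ` J))"
    using tip_edge_card by (fastforce simp: edges_def generated_def face_dim_def)
qed

lemma leaves_star:
  assumes "2 \<le> n"
  shows "leaves (generated (tip_edge ` {..<n})) = vertex 0 ` {..<n}"
proof -
  have iff: "(\<exists>!e. e \<in> tip_edge ` {..<n} \<and> v \<in> e) \<longleftrightarrow> v \<in> vertex 0 ` {..<n}" for v
  proof
    assume ex: "\<exists>!e. e \<in> tip_edge ` {..<n} \<and> v \<in> e"
    have "v \<noteq> 0"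
    proof
      assume "v = 0"
      moreover have "0 \<in> tip_edge i" for i by (simp add: tip_edge_def)
      moreover have "tip_edge 0 \<in> tip_edge ` {..<n}" "tip_edge 1 \<in> tip_edge ` {..<n}"
        using assms by auto
      ultimately have "tip_edge 0 = tip_edge 1" using ex by blast
      then show False by simp
    qed
    then show "v \<in> vertex 0 ` {..<n}" using ex by (auto simp: tip_edge_def)
  next
    assume "v \<in> vertex 0 ` {..<n}"
    then show "\<exists>!e. e \<in> tip_edge ` {..<n} \<and> v \<in> e"
      by (auto simp: tip_edge_def)
  qed
  have "vertex 0 ` {..<n} \<subseteq> \<Union>(tip_edge ` {..<n})"
    by (auto simp: tip_edge_def)
  then show ?thesis
    unfolding leaves_def edges_star Union_generated iff by blast
qed

section \<open>Existence of the turbine\<close>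

theorem theorem1p2:
  fixes n :: nat
  assumes "n \<ge> 1"
  shows "\<exists>(T :: nat set set) \<Upsilon>.
    abstract_complex T \<and> subcomplex \<Upsilon> T \<and>
    (shellable T \<and> contractible_complex T \<and> has_dim T 2 \<and>
      card (free_edges T) = n \<and> free_faces T = free_edges T) \<and>
    (let F = free_edges T; Y = \<Upsilon> \<union> generated F in
      shellable Y \<and> contractible_complex Y \<and> has_dim Y 1 \<and>
      (n \<ge> 2 \<longrightarrow> card (leaves Y) = n) \<and>
      (\<forall>v\<in>leaves Y. \<forall>e\<in>edges Y. v \<in> e \<longrightarrow> e \<in> F)) \<and>
    (\<forall>E. E \<subset> free_edges T \<longrightarrow> relative_shellable T (\<Upsilon> \<union> generated E))"
proof (intro exI conjI)
  let ?S = "turbine_triangles n" and ?F = "tip_edge ` {..<n}"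
  let ?T = "generated ?S"
  have F: "?F \<noteq> {}" using assms by (auto simp: lessThan_empty_iff)
  have "{} \<subset> ?F" using F by blast
  from buildable_turbine_relative[OF assms this]
  obtain \<sigma>s where \<sigma>s: "set \<sigma>s = ?S" "buildable {} \<sigma>s" by auto
  have "?S \<noteq> {}" using tip_edges_in_turbine[of n] F by auto
  show "abstract_complex ?T" by (rule abstract_complex_turbine)
  show "subcomplex {} ?T" by (simp add: subcomplex_def abstract_complex_def)
  show "shellable ?T"
    using buildable_shellable[of \<sigma>s 2] turbine_triangles_card[of _ n] \<sigma>s by simp
  show "contractible_complex ?T"
  proof -
    have "\<sigma>s \<noteq> []" using \<sigma>s(1) \<open>?S \<noteq> {}\<close> by auto
    then show ?thesis
      using buildable_contractible[OF _ \<sigma>s(2)] turbine_triangles_card[of _ n] \<sigma>s(1) by simp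
  qed
  show "has_dim ?T 2"
    using pure_of_dim_generated[of ?S 3] turbine_triangles_card[of _ n] \<open>?S \<noteq> {}\<close>
    by (simp add: pure_of_dim_def)
  show "card (free_edges ?T) = n"
    by (simp add: free_edges_turbine card_image inj_on_def)
  show "free_faces ?T = free_edges ?T"
    by (simp add: free_edges_turbine free_faces_turbine)
  show "let F = free_edges ?T; Y = {} \<union> generated F in
      shellable Y \<and> contractible_complex Y \<and> has_dim Y 1 \<and>
      (n \<ge> 2 \<longrightarrow> card (leaves Y) = n) \<and>
      (\<forall>v\<in>leaves Y. \<forall>e\<in>edges Y. v \<in> e \<longrightarrow> e \<in> F)"
  proof -
    let ?fs = "map tip_edge [0..<n]"
    have fs: "set ?fs = ?F" by (simp add: atLeast0LessThan)
    have "shellable (generated ?F)"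
      using buildable_shellable[OF _ buildable_star, of n 1] tip_edge_card unfolding fs by simp
    moreover have "contractible_complex (generated ?F)"
      using buildable_contractible[OF _ buildable_star, of n] tip_edge_card assms unfolding fs by auto
    moreover have "has_dim (generated ?F) 1"
      using pure_of_dim_generated[OF tip_edge_card F] by (simp add: pure_of_dim_def)
    moreover have "card (leaves (generated ?F)) = n" if "n \<ge> 2"
      using leaves_star[OF that] by (simp add: card_image inj_on_def)
    ultimately show ?thesis
      by (simp add: Let_def free_edges_turbine edges_star)
  qed
  show "\<forall>E. E \<subset> free_edges ?T \<longrightarrow> relative_shellable ?T ({} \<union> generated E)"
  proof (intro allI impI)
    fix E assume "E \<subset> free_edges ?T"
    then have E: "E \<subset> ?F" by (simp add: free_edges_turbine)
    from buildable_turbine_relative[OF assms E]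
    obtain \<tau>s where \<tau>s: "set \<tau>s = ?S" "buildable (generated E) \<tau>s" by auto
    have "finite E" by (rule finite_subset[OF psubset_imp_subset[OF E]]) simp
    moreover have "finite e" if "e \<in> E" for e
      using that E tip_edge_card[of e "{..<n}"] by blast
    ultimately have "abstract_complex (generated E)"
      by (rule abstract_complex_generated)
    moreover have "E \<subseteq> ?T" using E tip_edges_in_turbine by blast
    then have "generated E \<subseteq> ?T" by (rule generated_subset[OF abstract_complex_turbine])
    ultimately have "subcomplex (generated E) ?T" by (simp add: subcomplex_def)
    then show "relative_shellable ?T ({} \<union> generated E)"
      using buildable_relative_shellable[of \<tau>s 3 "generated E"] turbine_triangles_card[of _ n] \<tau>s
      by simp
  qed
qed

end
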